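(* Assume the $abc$-conjecture: for every $\epsilon>0$ there is a constant $\kappa(\epsilon)>0$ such that whenever $a,b,c$ are coprime positive integers with $a+b=c$, one has $c<\kappa(\epsilon)\,\mathrm{Rad}(abc)^{1+\epsilon}$. Let $m\ge 3$ and $k\ge 2$ be integers. Then for every $\epsilon>0$ there is a constant $C>0$, depending only on $\epsilon,k,m$, such that for all positive integers $N,d$ for which each of $N, N+d, \ldots, N+(m-1)d$ is $k$-full, we have $$\gcd(d,N)\ \ge\ C\,(\max\{d,N\})^{\frac{m(1-1/k)-2}{m(1-1/k^2)-2}-\epsilon},$$ $$d\ \ge\ C\,N^{\frac{m(1-1/k)-1}{m(1-1/k^2)-1}-\epsilon},$$ $$N\ \ge\ C\,d^{\frac{m(1-1/k)+1/k-2}{m(1-1/k^2)+1/k-2}-\epsilon}.$$ If, further, $m\ge 2k-1$, then (again with $C>0$ depending only on $\epsilon,k,m$) the stronger inequalities $$\gcd(d,N)\ \ge\ C\,(\max\{d,N\})^{\frac{m(1-1/k)-2}{m(1-1/(2k-1))-2}-\epsilon},$$ $$d\ \ge\ C\,N^{\frac{m(1-1/k)-1}{m(1-1/(2k-1))-1}-\epsilon},$$ $$N\ \ge\ C\,d^{\frac{m(1-1/k)+1/k-2}{m(1-1/(2k-1))+1/k-2}-\epsilon}$$ hold.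
   Context: For an integer $k\ge 2$, a positive integer $n$ is called $k$-full if every prime $p$ dividing $n$ satisfies $p^k\mid n$. For a positive integer $n$, $\mathrm{Rad}(n)$ denotes the product of the distinct primes dividing $n$ (with $\mathrm{Rad}(1)=1$). *)

theory Defs
  imports Complex_Main "HOL-Computational_Algebra.Primes"
begin

definition k_full :: "nat \<Rightarrow> nat \<Rightarrow> bool" where
  "k_full k n \<longleftrightarrow> n > 0 \<and> (\<forall>p. prime p \<longrightarrow> p dvd n \<longrightarrow> p ^ k dvd n)"

definition Rad :: "nat \<Rightarrow> nat" where
  "Rad n = \<Prod>(prime_factors n)"

definition abc_conjecture :: bool where
  "abc_conjecture \<longleftrightarrow>
     (\<forall>\<epsilon>>0::real. \<exists>\<kappa>>0::real. \<forall>a b c::nat.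
        a > 0 \<longrightarrow> b > 0 \<longrightarrow> c > 0 \<longrightarrow> Gcd {a, b, c} = 1 \<longrightarrow> a + b = c \<longrightarrow>
        real c < \<kappa> * real (Rad (a * b * c)) powr (1 + \<epsilon>))"

end

theory Submission
  imports Defs
begin

text \<open>
  Let \<open>F(x) = \<Prod>(x + i y)^((-1)^i binom(r, i))\<close> over \<open>0 \<le> i \<le> r\<close>, with \<open>r = m - 1\<close>. Write \<open>F = A/B\<close>,
  where \<open>A\<close> and \<open>B\<close> are forms of degree \<open>D = 2^(r - 1)\<close>. Passing from \<open>r\<close> to \<open>r + 1\<close> replaces
  \<open>F(x)\<close> by \<open>F(x) / F(x + y)\<close>, so by induction \<open>A - B = y^r G\<close> with \<open>G\<close> of degree \<open>D - r\<close>.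
  For coprime \<open>x = n\<close>, \<open>y = \<delta>\<close> the values \<open>A\<close>, \<open>B\<close> have bounded gcd, and \<open>max A B \<ge> M^D\<close> with
  \<open>M = max n \<delta>\<close>. If \<open>A = B\<close>, then \<open>M\<close> is bounded; otherwise the abc-conjecture for \<open>A - B = y^r G\<close> gives
  \<open>Rad (\<Prod>(n + i \<delta>)) Rad \<delta> \<ge> C M^(m - 1 - \<epsilon>)\<close>.

  Now put \<open>g = gcd d N\<close>, \<open>N = g n\<close>, \<open>d = g \<delta>\<close>. Every \<open>g (n + i \<delta>)\<close> is \<open>k\<close>-full, hence
  \<open>Rad (\<Prod>(n + i \<delta>))^k\<close> divides \<open>g \<Prod>(n + i \<delta>)\<close>, which is at most a constant times \<open>g n M^(m - 1)\<close>.
  Combining the two bounds yields, in logarithms, a single linear inequality between \<open>g\<close>, \<open>n\<close> and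
  \<open>\<delta>\<close>, from which all six estimates follow by linear arithmetic.
\<close>

section \<open>Radicals\<close>

lemma prod_prime_powers_dvd:
  fixes n :: nat
  assumes "finite S" "\<And>p. p \<in> S \<Longrightarrow> prime p" "\<And>p. p \<in> S \<Longrightarrow> p ^ e p dvd n"
  shows "(\<Prod>p\<in>S. p ^ e p) dvd n"
  using assms
proof (induction S rule: finite_induct)
  case (insert q S)
  have "coprime (q ^ e q) (\<Prod>p\<in>S. p ^ e p)"
    using insert.hyps insert.prems(1)
    by (intro prod_coprime_right coprime_power_left_iff[THEN iffD2] disjI1 coprime_power_right_iff[THEN iffD2])
       (metis insertCI primes_coprime)
  then show ?case using insert by (simp add: divides_mult)
qed simp

lemma Rad_pos: "Rad n > 0"
  unfolding Rad_def by (intro prod_pos) (auto simp: in_prime_factors_iff prime_gt_0_nat)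

lemma Rad_mono: "prime_factors a \<subseteq> prime_factors b \<Longrightarrow> Rad a \<le> Rad b"
  using dvd_imp_le[OF prod_dvd_prod_subset[of "prime_factors b" "prime_factors a" "\<lambda>x. x"]] Rad_pos[of b]
  by (simp add: Rad_def)

lemma Rad_le:
  assumes "n > 0"
  shows "Rad n \<le> n"
proof -
  have "(\<Prod>p\<in>prime_factors n. p ^ 1) dvd n"
    by (rule prod_prime_powers_dvd) auto
  with assms show ?thesis by (simp add: Rad_def dvd_imp_le)
qed

lemma Rad_mult_le:
  assumes "a > 0" "b > 0"
  shows "Rad (a * b) \<le> Rad a * Rad b"
proof -
  have "prod (\<lambda>x. x) (prime_factors a \<union> prime_factors b) * prod (\<lambda>x. x) (prime_factors a \<inter> prime_factors b)
      = Rad a * Rad b"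
    unfolding Rad_def by (rule prod.union_inter) auto
  moreover have "prod (\<lambda>x. x) (prime_factors a \<inter> prime_factors b) > 0"
    by (intro prod_pos) (auto simp: in_prime_factors_iff prime_gt_0_nat)
  moreover have "Rad (a * b) = prod (\<lambda>x. x) (prime_factors a \<union> prime_factors b)"
    using assms by (simp add: Rad_def prime_factors_product)
  ultimately show ?thesis
    by (metis One_nat_def Suc_leI mult.right_neutral mult_le_mono2)
qed

section \<open>Integral binary forms\<close>

text \<open>Homogeneous forms of degree \<open>e\<close> are encoded as functions by peeling off the
  leading power of \<open>x\<close>. In positive degree the leading coefficient is then the value at
  (1, 0), and a form vanishing there is visibly divisible by \<open>y\<close>.\<close>

fun binary_form :: "nat \<Rightarrow> (int \<Rightarrow> int \<Rightarrow> int) \<Rightarrow> bool" where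
  "binary_form 0 F \<longleftrightarrow> (\<exists>c. F = (\<lambda>x y. c))"
| "binary_form (Suc e) F \<longleftrightarrow> (\<exists>c G. binary_form e G \<and> F = (\<lambda>x y. c * x ^ Suc e + y * G x y))"

lemma binary_form_add:
  "binary_form e F \<Longrightarrow> binary_form e G \<Longrightarrow> binary_form e (\<lambda>x y. F x y + G x y)"
proof (induction e arbitrary: F G)
  case (Suc e)
  then obtain c F' d G' where *: "binary_form e F'" "F = (\<lambda>x y. c * x ^ Suc e + y * F' x y)"
    "binary_form e G'" "G = (\<lambda>x y. d * x ^ Suc e + y * G' x y)" by auto
  then have "binary_form e (\<lambda>x y. F' x y + G' x y)" using Suc.IH by blast
  moreover have "(\<lambda>x y. F x y + G x y) = (\<lambda>x y. (c + d) * x ^ Suc e + y * (F' x y + G' x y))"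
    by (auto simp: * algebra_simps)
  ultimately show ?case unfolding binary_form.simps by blast
qed auto

lemma binary_form_smult: "binary_form e F \<Longrightarrow> binary_form e (\<lambda>x y. c * F x y)"
proof (induction e arbitrary: F)
  case (Suc e)
  then obtain d F' where *: "binary_form e F'" "F = (\<lambda>x y. d * x ^ Suc e + y * F' x y)" by auto
  then have "binary_form e (\<lambda>x y. c * F' x y)" using Suc.IH by blast
  moreover have "(\<lambda>x y. c * F x y) = (\<lambda>x y. (c * d) * x ^ Suc e + y * (c * F' x y))"
    by (auto simp: * algebra_simps)
  ultimately show ?case unfolding binary_form.simps by blast
qed auto

lemma binary_form_diff:
  "binary_form e F \<Longrightarrow> binary_form e G \<Longrightarrow> binary_form e (\<lambda>x y. F x y - G x y)"
  using binary_form_add[of e F "\<lambda>x y. -1 * G x y"] binary_form_smult[of e G "-1"] by simp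

lemma binary_form_mult_y: "binary_form e F \<Longrightarrow> binary_form (Suc e) (\<lambda>x y. y * F x y)"
  by (auto intro!: exI[of _ 0] exI[of _ F])

lemma binary_form_mult_x: "binary_form e F \<Longrightarrow> binary_form (Suc e) (\<lambda>x y. x * F x y)"
proof (induction e arbitrary: F)
  case 0
  then obtain c where "F = (\<lambda>x y. c)" by auto
  then have "(\<lambda>x y. x * F x y) = (\<lambda>x y. c * x ^ Suc 0 + y * 0)" by (auto simp: mult.commute)
  then show ?case unfolding binary_form.simps by blast
next
  case (Suc e)
  then obtain c F' where *: "binary_form e F'" "F = (\<lambda>x y. c * x ^ Suc e + y * F' x y)" by auto
  then have "binary_form (Suc e) (\<lambda>x y. x * F' x y)" using Suc.IH by blast
  moreover have "(\<lambda>x y. x * F x y) = (\<lambda>x y. c * x ^ Suc (Suc e) + y * (x * F' x y))"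
    by (auto simp: * algebra_simps)
  ultimately show ?case unfolding binary_form.simps(2)[of "Suc e"] by blast
qed

lemma binary_form_mult_x_power: "binary_form e F \<Longrightarrow> binary_form (j + e) (\<lambda>x y. x ^ j * F x y)"
proof (induction j)
  case (Suc j)
  then show ?case using binary_form_mult_x[of "j + e" "\<lambda>x y. x ^ j * F x y"] by (simp add: mult.assoc)
qed simp

lemma binary_form_mult:
  "binary_form e F \<Longrightarrow> binary_form f G \<Longrightarrow> binary_form (e + f) (\<lambda>x y. F x y * G x y)"
proof (induction e arbitrary: F)
  case 0
  then show ?case using binary_form_smult by auto
next
  case (Suc e)
  then obtain c F' where *: "binary_form e F'" "F = (\<lambda>x y. c * x ^ Suc e + y * F' x y)" by auto
  have "binary_form (Suc e + f) (\<lambda>x y. c * (x ^ Suc e * G x y) + y * (F' x y * G x y))"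
    using binary_form_add[OF binary_form_smult[OF binary_form_mult_x_power[OF Suc.prems(2), of "Suc e"], of c]
        binary_form_mult_y[OF Suc.IH[OF *(1) Suc.prems(2)], simplified add_Suc[symmetric]]] .
  moreover have "(\<lambda>x y. F x y * G x y) = (\<lambda>x y. c * (x ^ Suc e * G x y) + y * (F' x y * G x y))"
    by (auto simp: * algebra_simps)
  ultimately show ?case by metis
qed

lemma binary_form_linear: "binary_form 1 (\<lambda>x y. x + j * y)"
proof -
  have "(\<lambda>x y. x + j * y) = (\<lambda>x y. 1 * x ^ Suc 0 + y * j)" by (auto simp: mult.commute)
  then show ?thesis unfolding One_nat_def binary_form.simps by blast
qed

lemma binary_form_shift: "binary_form e F \<Longrightarrow> binary_form e (\<lambda>x y. F (x + y) y)"
proof (induction e arbitrary: F)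
  case (Suc e)
  then obtain c F' where *: "binary_form e F'" "F = (\<lambda>x y. c * x ^ Suc e + y * F' x y)" by auto
  have pow: "binary_form j (\<lambda>x y. (x + y) ^ j)" for j
  proof (induction j)
    case (Suc j)
    then show ?case using binary_form_mult[OF binary_form_linear[of 1] Suc] by simp
  qed (simp add: exI[of _ 1])
  show ?case
    using binary_form_add[OF binary_form_smult[OF pow[of "Suc e"], of c] binary_form_mult_y[OF Suc.IH[OF *(1)]]]
    by (simp only: *)
qed auto

lemma binary_form_divide_y:
  assumes "binary_form (Suc e) F" "F 1 0 = 0"
  obtains G where "binary_form e G" "\<And>x y. F x y = y * G x y"
  using assms by auto

lemma binary_form_bound:
  assumes "binary_form e F"
  shows "\<exists>K>0. \<forall>x y z. \<bar>x\<bar> \<le> z \<longrightarrow> \<bar>y\<bar> \<le> z \<longrightarrow> \<bar>F x y\<bar> \<le> K * z ^ e"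
  using assms
proof (induction e arbitrary: F)
  case 0
  then obtain c where "F = (\<lambda>x y. c)" by auto
  then show ?case by (intro exI[of _ "\<bar>c\<bar> + 1"]) auto
next
  case (Suc e)
  then obtain c G where *: "binary_form e G" "F = (\<lambda>x y. c * x ^ Suc e + y * G x y)" by auto
  with Suc.IH obtain K where K: "K > 0" "\<And>x y z. \<bar>x\<bar> \<le> z \<Longrightarrow> \<bar>y\<bar> \<le> z \<Longrightarrow> \<bar>G x y\<bar> \<le> K * z ^ e"
    by blast
  show ?case
  proof (intro exI[of _ "\<bar>c\<bar> + K"] conjI allI impI)
    fix x y z :: int
    assume xy: "\<bar>x\<bar> \<le> z" "\<bar>y\<bar> \<le> z"
    have "\<bar>F x y\<bar> \<le> \<bar>c\<bar> * \<bar>x\<bar> ^ Suc e + \<bar>y\<bar> * \<bar>G x y\<bar>"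
      unfolding * by (metis abs_mult abs_triangle_ineq power_abs)
    also have "\<dots> \<le> \<bar>c\<bar> * z ^ Suc e + z * (K * z ^ e)"
      using xy K(2)[OF xy] by (intro add_mono mult_mono power_mono) auto
    finally show "\<bar>F x y\<bar> \<le> (\<bar>c\<bar> + K) * z ^ Suc e"
      by (simp add: algebra_simps)
  qed (use K(1) in auto)
qed

section \<open>The alternating product identity\<close>

text \<open>Index lists with multiplicities: \<open>i\<close> occurs \<open>r choose i\<close> times, in the first list if \<open>i\<close>
  is even and in the second if \<open>i\<close> is odd.\<close>

fun even_indices odd_indices :: "nat \<Rightarrow> nat list" where
  "even_indices 0 = [0]"
| "even_indices (Suc r) = even_indices r @ map Suc (odd_indices r)"
| "odd_indices 0 = []"
| "odd_indices (Suc r) = odd_indices r @ map Suc (even_indices r)"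

text \<open>Polymorphic, so that the same product can be read over \<open>int\<close> as a binary
  form and over \<open>nat\<close> in divisibility and radical arguments.\<close>

definition ap_prod :: "nat list \<Rightarrow> 'a \<Rightarrow> 'a \<Rightarrow> 'a :: comm_semiring_1" where
  "ap_prod is x y = (\<Prod>i\<leftarrow>is. x + of_nat i * y)"

lemma ap_prod_simps [simp]:
  "ap_prod [] x y = 1"
  "ap_prod (i # is) x y = (x + of_nat i * y) * ap_prod is x y"
  "ap_prod (is @ js) x y = ap_prod is x y * ap_prod js x y"
  by (simp_all add: ap_prod_def)

lemma ap_prod_map_Suc: "ap_prod (map Suc is) x y = ap_prod is (x + y) y"
  by (induction "is") (simp_all add: algebra_simps)

lemma ap_prod_of_nat: "of_nat (ap_prod is x y) = ap_prod is (of_nat x) (of_nat y)"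
  by (induction "is") simp_all

lemma binary_form_ap_prod: "binary_form (length is) (ap_prod is)"
proof (induction "is")
  case (Cons i "is")
  have "binary_form (1 + length is) (\<lambda>x y. (x + int i * y) * ap_prod is x y)"
    by (intro binary_form_mult binary_form_linear Cons)
  moreover have "(\<lambda>x y. (x + int i * y) * ap_prod is x y) = ap_prod (i # is)" by (simp add: fun_eq_iff)
  ultimately show ?case by (metis One_nat_def length_Cons plus_1_eq_Suc)
qed (auto simp: fun_eq_iff)

lemma indices_props:
  "i \<in> set (even_indices r) \<Longrightarrow> even i \<and> i \<le> r"
  "i \<in> set (odd_indices r) \<Longrightarrow> odd i \<and> i \<le> r"
  by (induction r arbitrary: i) (auto simp: le_SucI)

lemma length_indices:
  "length (even_indices (Suc r)) = 2 ^ r" "length (odd_indices (Suc r)) = 2 ^ r"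
  by (induction r) auto

text \<open>One more level turns A, B into A(x,y) B(x+y,y) and B(x,y) A(x+y,y). Adding and
  subtracting B(x,y) B(x+y,y) expresses the new difference through the old one and its shift, so
  y^(r+1) factors out. The cofactor G(x,y) B(x+y,y) - G(x+y,y) B(x,y) vanishes at y = 0, where the
  shift is trivial, and this supplies one further \<open>y\<close>.\<close>

lemma ap_prod_indices_diff:
  "\<exists>G. binary_form (2 ^ r - Suc r) G \<and>
     (\<forall>x y. ap_prod (even_indices (Suc r)) x y - ap_prod (odd_indices (Suc r)) x y = y ^ Suc r * G x y)"
proof (induction r)
  case 0
  \<comment> \<open>Here A = x and B = x + y.\<close>
  show ?case by (intro exI[of _ "\<lambda>x y. -1"]) auto
next
  case (Suc r)
  define A B where "A = (ap_prod (even_indices (Suc r)) :: int \<Rightarrow> _)"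
    and "B = (ap_prod (odd_indices (Suc r)) :: int \<Rightarrow> _)"
  obtain G where G: "binary_form (2 ^ r - Suc r) G" "\<And>x y. A x y - B x y = y ^ Suc r * G x y"
    using Suc unfolding A_def B_def by blast
  have fB: "binary_form (2 ^ r) B"
    using binary_form_ap_prod[of "odd_indices (Suc r)"] unfolding B_def length_indices .
  have B10: "ap_prod is 1 0 = (1::int)" for "is"
    by (induction "is") auto
  \<comment> \<open>Guarantees that the truncated subtractions in the degrees are exact;
    \<open>e\<close> is the degree left after the extra \<open>y\<close> is removed.\<close>
  have le: "Suc r \<le> 2 ^ r" by (induction r) auto
  define e where "e = (2::nat) ^ Suc r - Suc (Suc r)"
  have 1: "binary_form (2 ^ r - Suc r + 2 ^ r) (\<lambda>x y. G x y * B (x + y) y)"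
    by (intro binary_form_mult binary_form_shift G fB)
  have 2: "binary_form (2 ^ r - Suc r + 2 ^ r) (\<lambda>x y. G (x + y) y * B x y)"
    by (intro binary_form_mult G fB binary_form_shift[OF G(1)])
  have 3: "2 ^ r - Suc r + 2 ^ r = Suc e"
  proof -
    have "2 ^ r \<ge> (1::nat)" by simp
    then show ?thesis using le unfolding e_def by simp
  qed
  have "binary_form (Suc e) (\<lambda>x y. G x y * B (x + y) y - G (x + y) y * B x y)"
    using binary_form_diff[OF 1 2] unfolding 3 .
  then obtain H where H: "binary_form e H"
    "\<And>x y. G x y * B (x + y) y - G (x + y) y * B x y = y * H x y"
    by (rule binary_form_divide_y) (auto simp: B_def B10)
  have "ap_prod (even_indices (Suc (Suc r))) x y - ap_prod (odd_indices (Suc (Suc r))) x y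
     = y ^ Suc (Suc r) * H x y" for x y :: int
  proof -
    have "ap_prod (even_indices (Suc (Suc r))) x y - ap_prod (odd_indices (Suc (Suc r))) x y
        = A x y * B (x + y) y - B x y * A (x + y) y"
      unfolding even_indices.simps(2)[of "Suc r"] odd_indices.simps(2)[of "Suc r"] ap_prod_simps
        ap_prod_map_Suc A_def B_def ..
    also have "\<dots> = (A x y - B x y) * B (x + y) y - B x y * (A (x + y) y - B (x + y) y)"
      by (simp add: algebra_simps)
    also have "\<dots> = y ^ Suc r * (G x y * B (x + y) y - G (x + y) y * B x y)"
      unfolding G(2) by (simp add: algebra_simps)
    finally show ?thesis unfolding H(2) by simp
  qed
  then show ?case using H(1) unfolding e_def by blast
qed

section \<open>Consequences of the abc-conjecture\<close>

lemma gcd_mult_dvd_mult_gcd: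
  fixes a b c :: nat
  shows "gcd a (b * c) dvd gcd a b * gcd a c"
proof -
  have "gcd a (b * c) dvd gcd (c * a) (c * b)"
    by (intro gcd_greatest) (simp_all add: mult.commute[of b])
  then have "gcd a (b * c) dvd gcd a b * c"
    by (simp only: gcd_mult_distrib_nat[symmetric] mult.commute[of _ c])
  then have "gcd a (b * c) dvd gcd (gcd a b * a) (gcd a b * c)"
    by (intro gcd_greatest) simp_all
  then show ?thesis by (simp add: gcd_mult_distrib_nat[symmetric])
qed

lemma gcd_prod_list_dvd:
  fixes a L :: nat
  assumes "\<And>b. b \<in> set bs \<Longrightarrow> gcd a b dvd L"
  shows "gcd a (prod_list bs) dvd L ^ length bs"
  using assms
proof (induction bs)
  case (Cons b bs)
  have "gcd a (b * prod_list bs) dvd gcd a b * gcd a (prod_list bs)"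
    by (rule gcd_mult_dvd_mult_gcd)
  also have "\<dots> dvd L * L ^ length bs"
    using Cons by (intro mult_dvd_mono) auto
  finally show ?case by simp
qed simp

lemma gcd_ap_terms_dvd_fact:
  fixes n d :: nat
  assumes "coprime n d" "i \<noteq> j" "i \<le> r" "j \<le> r"
  shows "gcd (n + i * d) (n + j * d) dvd fact r"
  using assms
proof (induction i j rule: linorder_wlog)
  case (le i j)
  let ?g = "gcd (n + i * d) (n + j * d)"
  have "?g dvd (n + j * d) - (n + i * d)" by (intro dvd_diff_nat) auto
  then have "?g dvd (j - i) * d" by (simp add: diff_mult_distrib)
  moreover have "coprime (n + i * d) d"
    using le(2) by (simp add: coprime_iff_gcd_eq_1 gcd.commute[of _ d] add.commute[of n] gcd_add_mult)
  then have "coprime ?g d" by (meson coprime_divisors dvd_refl gcd_dvd1)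
  ultimately have "?g dvd j - i" using coprime_dvd_mult_left_iff by blast
  also have "j - i dvd fact r" using le by (intro dvd_fact) auto
  finally show ?case .
next
  case (sym i j)
  then show ?case by (metis gcd.commute)
qed

text \<open>Parity separates the two index lists, so \<open>gcd_ap_terms_dvd_fact\<close> applies to
  every pair consisting of an even and an odd term. Multiplying up over each list in turn accounts
  for the two exponents \<open>2 ^ q\<close>.\<close>

lemma gcd_ap_prod_indices_dvd:
  fixes n d :: nat
  assumes "coprime n d"
  shows "gcd (ap_prod (even_indices (Suc q)) n d) (ap_prod (odd_indices (Suc q)) n d)
    dvd ((fact (Suc q)) ^ 2 ^ q) ^ 2 ^ q"
proof -
  let ?T = "map (\<lambda>i. n + of_nat i * d)"
  have "gcd (ap_prod (even_indices (Suc q)) n d) (prod_list (?T (odd_indices (Suc q))))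
      dvd (fact (Suc q) ^ length (?T (even_indices (Suc q)))) ^ length (?T (odd_indices (Suc q)))"
  proof (rule gcd_prod_list_dvd)
    fix b assume "b \<in> set (?T (odd_indices (Suc q)))"
    then obtain j where j: "j \<in> set (odd_indices (Suc q))" "b = n + j * d"
      by (auto simp del: odd_indices.simps)
    have "gcd b (prod_list (?T (even_indices (Suc q)))) dvd fact (Suc q) ^ length (?T (even_indices (Suc q)))"
    proof (rule gcd_prod_list_dvd)
      fix a assume "a \<in> set (?T (even_indices (Suc q)))"
      then obtain i where "i \<in> set (even_indices (Suc q))" "a = n + i * d"
        by (auto simp del: even_indices.simps)
      moreover from this j have "i \<noteq> j" "i \<le> Suc q" "j \<le> Suc q"
        using indices_props by blast+
      ultimately show "gcd b a dvd fact (Suc q)"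
        using j(2) gcd_ap_terms_dvd_fact[OF assms, of j i] by metis
    qed
    then show "gcd (ap_prod (even_indices (Suc q)) n d) b dvd fact (Suc q) ^ length (?T (even_indices (Suc q)))"
      by (simp only: ap_prod_def gcd.commute)
  qed
  then show ?thesis by (simp only: ap_prod_def length_map length_indices)
qed

lemma ap_prod_pos:
  fixes n d :: nat
  assumes "n > 0"
  shows "ap_prod is n d > 0"
  by (induction "is") (use assms in auto)

lemma prime_dvd_ap_prod:
  fixes n d :: nat
  assumes "prime p" "p dvd ap_prod is n d" "\<And>i. i \<in> set is \<Longrightarrow> i < m"
  shows "p dvd (\<Prod>i<m. n + i * d)"
  using assms(2,3)
proof (induction "is")
  case (Cons i "is")
  then have "p dvd n + i * d \<or> p dvd ap_prod is n d"
    using assms(1) by (simp add: prime_dvd_mult_iff)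
  moreover have "n + i * d dvd (\<Prod>i<m. n + i * d)"
    using Cons.prems by (intro dvd_prodI) auto
  ultimately show ?case using Cons dvd_trans by auto
qed (use assms(1) in auto)

text \<open>A term with positive index is at least \<open>n\<close> and at least \<open>d\<close>;
  index 0 would give only \<open>n\<close>. Hence the later use on the odd list.\<close>

lemma ap_prod_ge:
  fixes n d :: nat
  assumes "\<And>i. i \<in> set is \<Longrightarrow> i > 0"
  shows "(max n d) ^ length is \<le> ap_prod is n d"
  using assms
proof (induction "is")
  case (Cons i "is")
  have "d \<le> i * d" using Cons.prems[of i] by (cases i) auto
  then have "max n d \<le> n + i * d" by (simp add: max_def trans_le_add2)
  then have "max n d * max n d ^ length is \<le> (n + i * d) * ap_prod is n d"
    using Cons by (intro mult_mono) auto
  then show ?case by simp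
qed simp

section \<open>The lower bound for the radical of the progression\<close>

text \<open>Apply abc to the triple divided by its gcd: the radical can only shrink, and undoing the
  division costs the factor \<open>gcd a c\<close>.\<close>

lemma abc_with_gcd:
  assumes abc_conjecture "\<eta> > 0"
  shows "\<exists>\<kappa>>0. \<forall>a c::nat. a > 0 \<longrightarrow> c > 0 \<longrightarrow>
    real (a + c) \<le> \<kappa> * real (gcd a c) * real (Rad (a * c * (a + c))) powr (1 + \<eta>)"
proof -
  obtain \<kappa> where \<kappa>: "\<kappa> > 0" "\<And>a b c::nat. a > 0 \<Longrightarrow> b > 0 \<Longrightarrow> c > 0 \<Longrightarrow> Gcd {a, b, c} = 1 \<Longrightarrow> a + b = c \<Longrightarrow>
        real c < \<kappa> * real (Rad (a * b * c)) powr (1 + \<eta>)"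
    using assms unfolding abc_conjecture_def by blast
  show ?thesis
  proof (intro exI[of _ \<kappa>] conjI allI impI \<kappa>(1))
    fix a c :: nat
    assume ac: "a > 0" "c > 0"
    define h where "h = gcd a c"
    obtain a' c' where *: "a = a' * h" "c = c' * h" "coprime a' c'"
      using ac gcd_coprime_exists[of a c] unfolding h_def by auto
    have h: "h > 0" using ac unfolding h_def by simp
    have pos: "a' > 0" "c' > 0" using * ac by (auto intro: Nat.gr0I)
    have "gcd c' (a' + c') = gcd a' c'"
      by (metis add.commute gcd.commute gcd_add2)
    then have "Gcd {a', c', a' + c'} = 1"
      using *(3) by (simp add: coprime_iff_gcd_eq_1)
    then have "real (a' + c') < \<kappa> * real (Rad (a' * c' * (a' + c'))) powr (1 + \<eta>)"
      using pos by (intro \<kappa>(2)) auto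
    also have "\<dots> \<le> \<kappa> * real (Rad (a * c * (a + c))) powr (1 + \<eta>)"
    proof -
      have "a' * c' * (a' + c') dvd a * c * (a + c)"
        unfolding * distrib_right[symmetric] by (intro mult_dvd_mono) auto
      moreover have "a * c * (a + c) \<noteq> 0" using ac by simp
      ultimately have "Rad (a' * c' * (a' + c')) \<le> Rad (a * c * (a + c))"
        by (intro Rad_mono dvd_prime_factors)
      then show ?thesis using \<kappa>(1) assms(2) by (intro mult_left_mono powr_mono2) auto
    qed
    finally have "real (a' + c') * real h \<le> \<kappa> * real (Rad (a * c * (a + c))) powr (1 + \<eta>) * real h"
      using h by (intro mult_right_mono) auto
    then show "real (a + c) \<le> \<kappa> * real (gcd a c) * real (Rad (a * c * (a + c))) powr (1 + \<eta>)"
      unfolding h_def[symmetric] using * by (simp add: algebra_simps)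
  qed
qed

lemma abc_Rad_ap_prod:
  assumes abc: abc_conjecture and "m \<ge> 2" and \<epsilon>: "\<epsilon> > 0"
  shows "\<exists>c. \<forall>n d::nat. n > 0 \<longrightarrow> d > 0 \<longrightarrow> coprime n d \<longrightarrow>
    (real m - 1 - \<epsilon>) * ln (real (max n d)) \<le> c + ln (real (Rad (\<Prod>i<m. n + i * d))) + ln (real (Rad d))"
proof -
  obtain q where q: "m = Suc (Suc q)" using \<open>m \<ge> 2\<close> by (metis Suc_le_D numeral_2_eq_2 Suc_le_mono)
  define D where "D = (2::nat) ^ q"
  \<comment> \<open>Chosen so that \<open>\<eta> * D = \<epsilon>\<close>, which makes a term cancel
    in the final rearrangement.\<close>
  define \<eta> where "\<eta> = \<epsilon> / D"
  have D: "D \<ge> Suc q" unfolding D_def by (induction q) auto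
  have \<eta>: "\<eta> > 0" "\<eta> * D = \<epsilon>" unfolding \<eta>_def using \<epsilon> D by auto
  obtain \<kappa> where \<kappa>: "\<kappa> > 0" "\<And>a c::nat. a > 0 \<Longrightarrow> c > 0 \<Longrightarrow>
    real (a + c) \<le> \<kappa> * real (gcd a c) * real (Rad (a * c * (a + c))) powr (1 + \<eta>)"
    using abc_with_gcd[OF abc \<eta>(1)] by blast
  obtain G where G: "binary_form (D - Suc q) G"
    "\<And>x y. ap_prod (even_indices (Suc q)) x y - ap_prod (odd_indices (Suc q)) x y = y ^ Suc q * G x y"
    using ap_prod_indices_diff[of q] unfolding D_def by blast
  obtain K0 where K0: "K0 > 0" "\<And>x y z. \<bar>x\<bar> \<le> z \<Longrightarrow> \<bar>y\<bar> \<le> z \<Longrightarrow> \<bar>G x y\<bar> \<le> K0 * z ^ (D - Suc q)"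
    using binary_form_bound[OF G(1)] by blast
  define K where "K = ((fact (Suc q) :: nat) ^ 2 ^ q) ^ 2 ^ q"
  have K: "K > 0" unfolding K_def by simp
  define c1 where "c1 = ln (\<kappa> * K) + (1 + \<eta>) * ln K0"
  \<comment> \<open>The first entry serves the abc case, the second the degenerate case
    \<open>A = B\<close>.\<close>
  define c where "c = max \<bar>c1\<bar> (m * ln K)"
  show ?thesis
  proof (intro exI[of _ c] allI impI)
    fix n d :: nat
    assume nd: "n > 0" "d > 0" "coprime n d"
    define M where "M = max n d"
    define A where "A = ap_prod (even_indices (Suc q)) n d"
    define B where "B = ap_prod (odd_indices (Suc q)) n d"
    define T where "T = (\<Prod>i<m. n + i * d)"
    have M: "M > 0" using nd unfolding M_def by simp
    have pos: "A > 0" "B > 0" "T > 0" using nd unfolding A_def B_def T_def by (auto intro: ap_prod_pos)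
    have BM: "M ^ D \<le> B"
      using ap_prod_ge[of "odd_indices (Suc q)" n d] indices_props(2)[of 0 "Suc q"]
      unfolding M_def B_def length_indices D_def by (metis dvd_0_right gr0I)
    have gcdK: "gcd A B \<le> K"
      using gcd_ap_prod_indices_dvd[OF nd(3), of q] K unfolding A_def B_def K_def by (intro dvd_imp_le)
    have lnRad: "ln (real (Rad x)) \<ge> 0" for x using Rad_pos[of x] by simp
    have lnM: "ln (real M) \<ge> 0" using M by simp
    show "(real m - 1 - \<epsilon>) * ln (real (max n d)) \<le> c + ln (real (Rad (\<Prod>i<m. n + i * d))) + ln (real (Rad d))"
    proof (cases "A = B")
      case True
      \<comment> \<open>If \<open>A = B\<close>, then \<open>B\<close> is its own gcd with
        \<open>A\<close>, so \<open>M ^ D \<le> B \<le> K\<close> bounds \<open>M\<close>.\<close>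
      have "M ^ 1 \<le> M ^ D" using M D by (intro power_increasing) auto
      also have "\<dots> \<le> K" using BM gcdK True by simp
      finally have "ln M \<le> ln K" using M by simp
      then have "(real m - 1 - \<epsilon>) * ln M \<le> m * ln K"
        using lnM \<epsilon> by (intro mult_mono) auto
      then show ?thesis using lnRad[of d] lnRad[of T] unfolding c_def M_def T_def by linarith
    next
      case False
      \<comment> \<open>The two products are ordered so that the smaller one plus the difference is
        the larger one, a triple in positive integers with the same gcd.\<close>
      define a where "a = min A B"
      define b where "b = max A B - a"
      have ab: "a > 0" "b > 0" "a + b = max A B" using pos False unfolding a_def b_def by auto
      have gab: "gcd a b = gcd A B"
        using gcd_diff1_nat[of A B] gcd_diff1_nat[of B A]
        unfolding a_def b_def by (cases "A \<le> B") (simp_all add: gcd.commute min_def max_def)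
      have "int b = \<bar>int A - int B\<bar>" unfolding a_def b_def by auto
      also have "\<dots> = int d ^ Suc q * \<bar>G (int n) (int d)\<bar>"
        using G(2)[of "int n" "int d"] ap_prod_of_nat[where ?'a = int, of _ n d]
        unfolding A_def B_def by (simp add: abs_mult)
      also have "\<dots> = int (d ^ Suc q * nat \<bar>G (int n) (int d)\<bar>)" by simp
      finally have b: "b = d ^ Suc q * nat \<bar>G (int n) (int d)\<bar>" using of_nat_eq_iff by blast
      define H where "H = nat \<bar>G (int n) (int d)\<bar>"
      have H: "H > 0" using ab b unfolding H_def by (auto intro: Nat.gr0I)
      have "\<bar>G (int n) (int d)\<bar> \<le> K0 * int M ^ (D - Suc q)"
        unfolding M_def by (rule K0) auto
      then have "real_of_int \<bar>G (int n) (int d)\<bar> \<le> real_of_int (K0 * int M ^ (D - Suc q))"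
        using of_int_le_iff by blast
      then have HM: "real H \<le> K0 * real M ^ (D - Suc q)" unfolding H_def by simp
      have "a * b * (a + b) = A * B * b"
        unfolding ab(3) by (simp add: a_def min_def max_def mult_ac)
      then have "Rad (a * b * (a + b)) = Rad (A * B * b)" by (rule arg_cong)
      also have "\<dots> \<le> Rad (A * B) * Rad b" using pos ab by (intro Rad_mult_le) auto
      also have "\<dots> \<le> Rad T * (Rad d * H)"
      proof (intro mult_mono)
        show "Rad (A * B) \<le> Rad T"
        proof (rule Rad_mono, rule subsetI)
          fix p assume "p \<in> prime_factors (A * B)"
          then have "prime p" "p dvd A \<or> p dvd B" by (auto simp: in_prime_factors_iff prime_dvd_mult_iff)
          moreover have "i < m" if "i \<in> set (even_indices (Suc q)) \<union> set (odd_indices (Suc q))" for i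
            using that indices_props[of i "Suc q"] unfolding q less_Suc_eq_le by blast
          ultimately have "p dvd T"
            unfolding T_def A_def B_def using prime_dvd_ap_prod[where m = m] by blast
          then show "p \<in> prime_factors T" using \<open>prime p\<close> pos by (simp add: in_prime_factors_iff)
        qed
        \<comment> \<open>The saving: the power of \<open>d\<close> in \<open>b\<close> contributes
          a single \<open>Rad d\<close>, while the cofactor \<open>H\<close>, of degree
          \<open>D - Suc q\<close>, is estimated trivially by its size.\<close>
        have "Rad b \<le> Rad (d ^ Suc q) * Rad H"
          unfolding b H_def[symmetric] using nd H by (intro Rad_mult_le) auto
        also have "\<dots> \<le> Rad d * H"
          using H by (intro mult_mono Rad_le Rad_mono) (auto simp: in_prime_factors_iff simp del: power_Suc dest: prime_dvd_power)
        finally show "Rad b \<le> Rad d * H" .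
      qed auto
      finally have "real (Rad (a * b * (a + b))) \<le> real (Rad T * (Rad d * H))" by (rule of_nat_mono)
      also have "\<dots> \<le> Rad T * (Rad d * (K0 * real M ^ (D - Suc q)))"
        using HM by (auto intro!: mult_left_mono)
      finally have R: "real (Rad (a * b * (a + b))) \<le> Rad T * (Rad d * (K0 * real M ^ (D - Suc q)))" .
      have "real M ^ D \<le> real (a + b)" using BM ab by (simp flip: of_nat_power)
      also have "\<dots> \<le> \<kappa> * real (gcd a b) * real (Rad (a * b * (a + b))) powr (1 + \<eta>)"
        by (rule \<kappa>) (use ab in auto)
      also have "\<dots> \<le> \<kappa> * K * (Rad T * (Rad d * (K0 * real M ^ (D - Suc q)))) powr (1 + \<eta>)"
        using R gcdK gab \<kappa>(1) \<eta>(1) by (intro mult_mono powr_mono2) auto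
      finally have "ln (real M ^ D) \<le> ln (\<kappa> * K * (Rad T * (Rad d * (K0 * real M ^ (D - Suc q)))) powr (1 + \<eta>))"
        using M by (intro ln_mono) auto
      also have "\<dots> = ln (\<kappa> * K) + (1 + \<eta>) * (ln (Rad T) + (ln (Rad d) + (ln K0 + (D - Suc q) * ln M)))"
        using M K \<kappa>(1) K0(1) Rad_pos[of T] Rad_pos[of d] by (simp add: ln_mult ln_powr ln_realpow)
      also have "real (D - Suc q) = real D - (real m - 1)" using D q by simp
      finally have main: "D * ln M \<le> c1 + (1 + \<eta>) * (ln (Rad T) + ln (Rad d) + (D - (real m - 1)) * ln M)"
        unfolding c1_def using M by (simp add: ln_realpow algebra_simps)
      \<comment> \<open>The bracket \<open>\<eta> * D - \<epsilon>\<close> is zero and the last term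
        is nonpositive, so \<open>main\<close> applies directly.\<close>
      have "(1 + \<eta>) * ((real m - 1 - \<epsilon>) * ln M)
          = D * ln M - (1 + \<eta>) * ((D - (real m - 1)) * ln M) + (\<eta> * D - \<epsilon>) * ln M - \<eta> * \<epsilon> * ln M"
        by (simp add: algebra_simps)
      also have "\<dots> \<le> c1 + (1 + \<eta>) * (ln (Rad T) + ln (Rad d))"
      proof -
        have "\<eta> * \<epsilon> * ln M \<ge> 0" using \<eta>(1) \<epsilon> lnM by simp
        then show ?thesis using main by (simp add: \<eta>(2) algebra_simps)
      qed
      also have "\<dots> \<le> (1 + \<eta>) * (\<bar>c1\<bar> + ln (Rad T) + ln (Rad d))"
      proof -
        have "\<eta> * \<bar>c1\<bar> \<ge> 0" using \<eta>(1) by simp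
        then show ?thesis by (simp add: algebra_simps)
      qed
      finally have "(real m - 1 - \<epsilon>) * ln M \<le> \<bar>c1\<bar> + ln (Rad T) + ln (Rad d)"
        using \<eta>(1) by simp
      then show ?thesis unfolding c_def M_def T_def by linarith
    qed
  qed
qed

section \<open>Full numbers in arithmetic progressions\<close>

text \<open>A prime of \<open>T\<close> divides some \<open>t i\<close>, so its k-th power divides
  \<open>g * t i\<close> and therefore \<open>g * T\<close>. One index per prime suffices, so a
  single factor \<open>g\<close> serves all primes.\<close>

lemma Rad_power_le_of_k_full:
  fixes m :: nat
  assumes "g > 0" "T = (\<Prod>i<m. t i)" "\<And>i. i < m \<Longrightarrow> k_full k (g * t i)"
  shows "Rad T ^ k \<le> g * T"
proof -
  have "Rad T ^ k = (\<Prod>p\<in>prime_factors T. p ^ k)"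
    unfolding Rad_def by (rule prod_power_distrib)
  also have "\<dots> dvd g * T"
  proof (rule prod_prime_powers_dvd)
    fix p assume "p \<in> prime_factors T"
    then have p: "prime p" "p dvd T" by (auto simp: in_prime_factors_iff)
    then obtain i where i: "i < m" "p dvd t i"
      unfolding assms(2) using prime_dvd_prod_iff[of "{..<m}" p t] by auto
    then have "p ^ k dvd g * t i" using assms(3) p(1) unfolding k_full_def by auto
    also have "\<dots> dvd g * T" unfolding assms(2) using i by (intro mult_dvd_mono dvd_prodI) auto
    finally show "p ^ k dvd g * T" .
  qed (auto simp: in_prime_factors_iff)
  finally show ?thesis
    using assms by (intro dvd_imp_le) (auto simp: k_full_def intro!: prod_pos)
qed

lemma abc_k_full_ap_bound:
  fixes m k :: nat
  assumes abc: abc_conjecture and m: "m \<ge> 3" and k: "k \<ge> 2" and \<epsilon>: "\<epsilon> > 0"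
  shows "\<exists>c\<ge>0. \<forall>g n d::nat. g > 0 \<longrightarrow> n > 0 \<longrightarrow> d > 0 \<longrightarrow> coprime n d \<longrightarrow>
    (\<forall>i<m. k_full k (g * (n + i * d))) \<longrightarrow>
    (real m - 1 - \<epsilon>) * ln (max n d) \<le> c + ln d + (ln g + ln n + (real m - 1) * ln (max n d)) / k"
proof -
  obtain c where c: "\<And>n d::nat. n > 0 \<Longrightarrow> d > 0 \<Longrightarrow> coprime n d \<Longrightarrow>
    (real m - 1 - \<epsilon>) * ln (real (max n d)) \<le> c + ln (real (Rad (\<Prod>i<m. n + i * d))) + ln (real (Rad d))"
    using abc_Rad_ap_prod[OF abc _ \<epsilon>, of m] m by auto
  show ?thesis
  proof (intro exI[of _ "\<bar>c\<bar> + (real m - 1) * ln m / k"] conjI allI impI)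
    fix g n d :: nat
    assume *: "g > 0" "n > 0" "d > 0" "coprime n d" and full: "\<forall>i<m. k_full k (g * (n + i * d))"
    define M where "M = max n d"
    define T where "T = (\<Prod>i<m. n + i * d)"
    have M: "M > 0" using * unfolding M_def by auto
    have T: "T > 0" using * unfolding T_def by auto
    obtain r where r: "m = Suc r" using m by (cases m) auto
    \<comment> \<open>The first term stays \<open>n\<close> instead of being replaced by a multiple
      of \<open>M\<close>. When \<open>n\<close> is far below \<open>M\<close> this is sharper, and
      the lower bound for \<open>N\<close> relies on it.\<close>
    have "T = n * (\<Prod>i<r. n + Suc i * d)"
      unfolding T_def r by (subst prod.lessThan_Suc_shift) simp
    also have "\<dots> \<le> n * (\<Prod>i<r. m * M)"
    proof (intro mult_left_mono prod_mono conjI)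
      fix i assume "i \<in> {..<r}"
      then have "n + Suc i * d \<le> M + r * M"
        unfolding M_def by (intro add_mono mult_mono) auto
      then show "n + Suc i * d \<le> m * M" by (simp add: r)
    qed auto
    finally have "real T \<le> real (n * (m * M) ^ r)" by (intro of_nat_mono) simp
    then have "ln T \<le> ln (real (n * (m * M) ^ r))" using T by simp
    also have "\<dots> = ln n + (real m - 1) * (ln m + ln M)"
    proof -
      have "real m - 1 = real r" by (simp add: r)
      then show ?thesis using * M m by (simp add: ln_mult ln_realpow)
    qed
    finally have lnT: "ln T \<le> ln n + (real m - 1) * (ln m + ln M)" .
    have "Rad T ^ k \<le> g * T"
      by (rule Rad_power_le_of_k_full) (use * full in \<open>auto simp: T_def\<close>)
    then have "real (Rad T) ^ k \<le> real g * real T" by (metis of_nat_le_iff of_nat_mult of_nat_power)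
    then have "ln (real (Rad T) ^ k) \<le> ln (real g * real T)"
      using Rad_pos[of T] * T by (simp del: of_nat_mult of_nat_power)
    then have "k * ln (Rad T) \<le> ln g + ln T"
      using Rad_pos[of T] * T by (simp add: ln_mult ln_realpow)
    then have "k * ln (Rad T) \<le> ln g + ln n + (real m - 1) * (ln m + ln M)" using lnT by simp
    then have "ln (Rad T) \<le> (ln g + ln n + (real m - 1) * (ln m + ln M)) / k"
      using k by (simp add: field_simps)
    also have "\<dots> = (ln g + ln n + (real m - 1) * ln M) / k + (real m - 1) * ln m / k"
      by (simp add: algebra_simps add_divide_distrib diff_divide_distrib)
    finally have "ln (Rad T) \<le> (ln g + ln n + (real m - 1) * ln M) / k + (real m - 1) * ln m / k" .
    moreover have "ln (Rad d) \<le> ln d" using Rad_le[of d] Rad_pos[of d] * by simp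
    moreover have "(real m - 1 - \<epsilon>) * ln M \<le> c + ln (Rad T) + ln (Rad d)"
      unfolding M_def T_def by (rule c) (use * in auto)
    ultimately show "(real m - 1 - \<epsilon>) * ln (max n d)
        \<le> \<bar>c\<bar> + (real m - 1) * ln m / k + ln d + (ln g + ln n + (real m - 1) * ln (max n d)) / k"
      unfolding M_def by linarith
  qed (use m in auto)
qed

section \<open>Linear arithmetic with logarithms\<close>

lemma powr_le_of_ln_le:
  fixes x y e c :: real
  assumes "x > 0" "y > 0" "e * ln x \<le> c + ln y"
  shows "exp (- c) * x powr e \<le> y"
proof -
  have "exp (- c) * x powr e = exp (e * ln x - c)"
    using assms by (simp add: powr_def exp_diff exp_minus field_simps)
  also have "\<dots> \<le> exp (ln y)"
    unfolding exp_le_cancel_iff using assms by simp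
  finally show ?thesis using assms by simp
qed

lemma quotient_exponent_bound:
  fixes u v e c L y :: real
  assumes "v > 0" "u * L \<le> c + v * y + e * v * L"
  shows "(u / v - e) * L \<le> c / v + y"
proof -
  have "(u / v - e) * L = (u * L - e * v * L) / v"
    using assms(1) by (simp add: field_simps)
  also have "\<dots> \<le> (c + v * y) / v"
    using assms by (intro divide_right_mono) auto
  also have "\<dots> = c / v + y"
    using assms(1) by (simp add: field_simps)
  finally show ?thesis .
qed

definition k_full_ap :: "nat \<Rightarrow> nat \<Rightarrow> nat \<Rightarrow> nat \<Rightarrow> bool" where
  "k_full_ap k m N d \<longleftrightarrow> N > 0 \<and> d > 0 \<and> (\<forall>i<m. k_full k (N + i * d))"

text \<open>The witnesses \<open>g\<close>, \<open>a\<close>, \<open>b\<close> are the logarithms of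
  \<open>gcd d N\<close>, \<open>N / gcd d N\<close> and \<open>d / gcd d N\<close>, nonnegative
  since these are positive integers. From here on only linear inequalities in them matter.\<close>

lemma k_full_ap_log_bound:
  fixes m k :: nat
  assumes abc: abc_conjecture and m: "m \<ge> 3" and k: "k \<ge> 2" and \<epsilon>: "\<epsilon> > 0"
  obtains c where "c \<ge> 0" "\<And>N d. k_full_ap k m N d \<Longrightarrow>
    \<exists>g a b. g \<ge> 0 \<and> a \<ge> 0 \<and> b \<ge> 0 \<and> ln (gcd d N) = g \<and> ln N = g + a \<and> ln d = g + b \<and>
      ln (max d N) = g + max a b \<and>
      (real m - 1 - \<epsilon>) * max a b \<le> c + b + (g + a + (real m - 1) * max a b) / k"
proof -
  obtain c where c: "c \<ge> 0" "\<And>g n d::nat. g > 0 \<Longrightarrow> n > 0 \<Longrightarrow> d > 0 \<Longrightarrow> coprime n d \<Longrightarrow>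
    (\<forall>i<m. k_full k (g * (n + i * d))) \<Longrightarrow>
    (real m - 1 - \<epsilon>) * ln (max n d) \<le> c + ln d + (ln g + ln n + (real m - 1) * ln (max n d)) / k"
    using abc_k_full_ap_bound[OF assms] by blast
  show ?thesis
  proof (rule that[OF c(1)])
    fix N d :: nat
    assume Nd: "k_full_ap k m N d"
    then have pos: "N > 0" "d > 0" unfolding k_full_ap_def by auto
    define g where "g = gcd d N"
    obtain \<delta> n where *: "d = \<delta> * g" "N = n * g" "coprime \<delta> n"
      using pos gcd_coprime_exists[of d N] unfolding g_def by auto
    have g: "g > 0" using pos unfolding g_def by simp
    have pos': "\<delta> > 0" "n > 0" using pos * by (auto intro: Nat.gr0I)
    have max: "ln (real (max x y)) = max (ln x) (ln y)" if "x > 0" "y > 0" for x y :: nat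
      using that by (auto simp: max_def)
    have "(real m - 1 - \<epsilon>) * ln (max n \<delta>) \<le> c + ln \<delta> + (ln g + ln n + (real m - 1) * ln (max n \<delta>)) / k"
    proof (rule c(2))
      show "\<forall>i<m. k_full k (g * (n + i * \<delta>))"
        using Nd unfolding k_full_ap_def * by (simp add: algebra_simps)
    qed (use g pos' *(3) in \<open>auto simp: coprime_commute\<close>)
    moreover have "ln (real (max d N)) = ln g + max (ln n) (ln \<delta>)"
      unfolding max[OF pos(2,1)] using * g pos' by (auto simp: ln_mult max_def)
    moreover have "gcd d N = g" by (simp add: g_def)
    ultimately show "\<exists>g a b. g \<ge> 0 \<and> a \<ge> 0 \<and> b \<ge> 0 \<and> ln (gcd d N) = g \<and> ln N = g + a \<and> ln d = g + b \<and>
      ln (max d N) = g + max a b \<and>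
      (real m - 1 - \<epsilon>) * max a b \<le> c + b + (g + a + (real m - 1) * max a b) / k"
      unfolding max[OF pos'(2,1)]
      by (intro exI[of _ "ln (real g)"] exI[of _ "ln (real n)"] exI[of _ "ln (real \<delta>)"])
         (use *(1,2) g pos' in \<open>simp_all add: ln_mult\<close>)
  qed
qed

text \<open>Treats both families of exponents at once through the parameter \<open>\<sigma>\<close>.
  With \<open>u\<close>, \<open>s\<close>, \<open>\<mu>\<close> as defined in the proof, the three
  quotients take the form w / (w + s) for w equal to \<open>\<mu>\<close>, \<open>\<mu> + 1\<close>
  and \<open>\<mu> + u\<close>; the estimates then rest on \<open>u \<le> s\<close> and
  \<open>\<mu> + s \<ge> 0\<close>.\<close>

lemma k_full_ap_exponents:
  fixes m k :: nat and \<sigma> \<epsilon> :: real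
  assumes abc: abc_conjecture and m: "m \<ge> 3" and k: "k \<ge> 2" and \<epsilon>: "\<epsilon> > 0"
    and \<sigma>: "\<sigma> \<le> 1 / (2 * real k - 1)"
  shows "\<exists>C>0. \<forall>N d::nat. N > 0 \<longrightarrow> d > 0 \<longrightarrow> (\<forall>i<m. k_full k (N + i * d)) \<longrightarrow>
     real (gcd d N) \<ge> C * real (max d N) powr ((m * (1 - 1 / k) - 2) / (m * (1 - \<sigma>) - 2) - \<epsilon>) \<and>
     real d \<ge> C * real N powr ((m * (1 - 1 / k) - 1) / (m * (1 - \<sigma>) - 1) - \<epsilon>) \<and>
     real N \<ge> C * real d powr ((m * (1 - 1 / k) + 1 / k - 2) / (m * (1 - \<sigma>) + 1 / k - 2) - \<epsilon>)"
proof -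
  define u where "u = 1 / real k"
  define s where "s = m * (u - \<sigma>)"
  define \<mu> where "\<mu> = m * (1 - u) - 2"
  have u: "u > 0" "u \<le> 1 / 2" unfolding u_def using k by (auto simp: field_simps)
  have "\<sigma> \<le> 1 / 3"
    using \<sigma> k by (rule_tac order_trans[OF \<sigma>]) (auto simp: field_simps)
  then have "m * (1 - \<sigma>) \<ge> 3 * (1 - 1 / 3)" using m by (intro mult_mono) auto
  then have \<mu>s: "\<mu> + s \<ge> 0" unfolding \<mu>_def s_def by (simp add: algebra_simps)
  \<comment> \<open>Equivalent to 2k - 1 \<le> 3(k - 1), that is k \<ge> 2. Multiplying by m \<ge> 3
    turns it into \<open>u \<le> s\<close>.\<close>
  have "u / 3 \<le> u - 1 / (2 * real k - 1)"
    unfolding u_def using k by (simp add: field_simps)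
  then have "u / 3 \<le> u - \<sigma>" using \<sigma> by simp
  then have "3 * (u / 3) \<le> s" unfolding s_def using m u by (intro mult_mono) auto
  then have s: "u \<le> s" by simp
  have "3 * (1 - u) \<le> m * (1 - u)" using m u by (intro mult_right_mono) auto
  then have \<mu>: "\<mu> \<ge> 1 - 3 * u" unfolding \<mu>_def by simp
  have exps: "m * (1 - 1 / k) - 2 = \<mu>" "m * (1 - \<sigma>) - 2 = \<mu> + s"
    "m * (1 - 1 / k) - 1 = \<mu> + 1" "m * (1 - \<sigma>) - 1 = \<mu> + 1 + s"
    "m * (1 - 1 / k) + 1 / k - 2 = \<mu> + u" "m * (1 - \<sigma>) + 1 / k - 2 = \<mu> + u + s"
    unfolding \<mu>_def s_def u_def by (simp_all add: algebra_simps)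
  \<comment> \<open>The coefficient arises from (m - 1)(1 - u) = \<mu> + 1 + u. The slack
    \<open>e\<close> stays free, since each estimate takes it to be \<epsilon> times its own
    denominator.\<close>
  have key: "\<exists>c\<ge>0. \<forall>N d. k_full_ap k m N d \<longrightarrow>
    (\<exists>g a b. g \<ge> 0 \<and> a \<ge> 0 \<and> b \<ge> 0 \<and> ln (gcd d N) = g \<and> ln N = g + a \<and> ln d = g + b \<and>
      ln (max d N) = g + max a b \<and> (\<mu> + 1 + u) * max a b \<le> c + b + u * (g + a) + e * max a b)"
    if "e > 0" for e
  proof -
    have u_eq: "y / k = u * y" for y by (simp add: u_def)
    have eq: "(real m - 1 - e) * x \<le> c + b + (g + a + (real m - 1) * x) / k \<longleftrightarrow>
      (\<mu> + 1 + u) * x \<le> c + b + u * (g + a) + e * x" for x c b g a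
      unfolding u_eq \<mu>_def by (simp add: algebra_simps)
    show ?thesis
      by (rule k_full_ap_log_bound[OF abc m k that]) (unfold eq, blast)
  qed
  have 1: "\<exists>C>0. \<forall>N d. k_full_ap k m N d \<longrightarrow> C * real (max d N) powr (\<mu> / (\<mu> + s) - \<epsilon>) \<le> real (gcd d N)"
  proof (cases "\<mu> > 0")
    case True
    have v: "\<mu> + s > 0" using True s u by linarith
    obtain c where c: "c \<ge> 0" "\<And>N d. k_full_ap k m N d \<Longrightarrow>
      \<exists>g a b. g \<ge> 0 \<and> a \<ge> 0 \<and> b \<ge> 0 \<and> ln (gcd d N) = g \<and> ln N = g + a \<and> ln d = g + b \<and>
      ln (max d N) = g + max a b \<and> (\<mu> + 1 + u) * max a b \<le> c + b + u * (g + a) + (\<epsilon> * (\<mu> + s)) * max a b"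
      using key[of "\<epsilon> * (\<mu> + s)"] \<epsilon> v by auto
    show ?thesis
    proof (intro exI[of _ "exp (- (c / (\<mu> + s)))"] conjI allI impI powr_le_of_ln_le)
      fix N d assume Nd: "k_full_ap k m N d"
      then obtain g a b where *: "g \<ge> 0" "a \<ge> 0" "b \<ge> 0" "ln (gcd d N) = g" "ln (max d N) = g + max a b"
        "(\<mu> + 1 + u) * max a b \<le> c + b + u * (g + a) + (\<epsilon> * (\<mu> + s)) * max a b"
        using c(2) by blast
      \<comment> \<open>Replacing \<open>a\<close> and \<open>b\<close> by their maximum leaves
        \<mu> times that maximum on the left; adding \<open>\<mu> * g\<close> to both sides gives
        the desired form.\<close>
      have "u * a \<le> u * max a b" "u * g \<le> s * g" "\<epsilon> * (\<mu> + s) * g \<ge> 0"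
        using u s * \<epsilon> v by (auto intro!: mult_right_mono mult_left_mono)
      moreover have "b \<le> max a b" by simp
      ultimately have "\<mu> * (g + max a b) \<le> c + (\<mu> + s) * g + \<epsilon> * (\<mu> + s) * (g + max a b)"
        using *(6) unfolding distrib_left distrib_right by linarith
      then show "(\<mu> / (\<mu> + s) - \<epsilon>) * ln (max d N) \<le> c / (\<mu> + s) + ln (gcd d N)"
        unfolding * by (rule quotient_exponent_bound[OF v])
    qed (auto simp: k_full_ap_def)
  next
    case False \<comment> \<open>includes \<open>m = 3\<close>, \<open>k = 2\<close>, \<open>\<sigma> = 1/3\<close>, where \<open>\<mu> + s = 0\<close> and the quotient is \<open>0\<close>\<close>
    then have "\<mu> / (\<mu> + s) \<le> 0" using \<mu>s by (simp add: divide_nonpos_nonneg)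
    then have e: "\<mu> / (\<mu> + s) - \<epsilon> \<le> 0" using \<epsilon> by simp
    show ?thesis
    \<comment> \<open>The exponent is not positive, so the constant 1 works; it is written
      \<open>exp (- 0)\<close> to fit \<open>powr_le_of_ln_le\<close>.\<close>
    proof (intro exI[of _ "exp (- 0)"] conjI allI impI powr_le_of_ln_le)
      fix N d assume "k_full_ap k m N d"
      then have "ln (real (max d N)) \<ge> 0" "ln (real (gcd d N)) \<ge> 0"
        by (auto simp: k_full_ap_def max_def Suc_le_eq)
      with e show "(\<mu> / (\<mu> + s) - \<epsilon>) * ln (max d N) \<le> 0 + ln (gcd d N)"
        using mult_nonpos_nonneg[OF e] by fastforce
    qed (auto simp: k_full_ap_def)
  qed
  have 2: "\<exists>C>0. \<forall>N d. k_full_ap k m N d \<longrightarrow> C * real N powr ((\<mu> + 1) / (\<mu> + 1 + s) - \<epsilon>) \<le> real d"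
  proof -
    have v: "\<mu> + 1 + s \<ge> 1" "\<mu> + 1 + s > 0" "\<mu> + 1 > 0" using \<mu>s \<mu> u by auto
    obtain c where c: "c \<ge> 0" "\<And>N d. k_full_ap k m N d \<Longrightarrow>
      \<exists>g a b. g \<ge> 0 \<and> a \<ge> 0 \<and> b \<ge> 0 \<and> ln (gcd d N) = g \<and> ln N = g + a \<and> ln d = g + b \<and>
      ln (max d N) = g + max a b \<and> (\<mu> + 1 + u) * max a b \<le> c + b + u * (g + a) + (\<epsilon> * (\<mu> + 1 + s)) * max a b"
      using key[of "\<epsilon> * (\<mu> + 1 + s)"] \<epsilon> v by auto
    show ?thesis
    proof (intro exI[of _ "exp (- (c / (\<mu> + 1 + s)))"] conjI allI impI powr_le_of_ln_le)
      fix N d assume Nd: "k_full_ap k m N d"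
      then obtain g a b where *: "g \<ge> 0" "a \<ge> 0" "b \<ge> 0" "ln N = g + a" "ln d = g + b"
        "(\<mu> + 1 + u) * max a b \<le> c + b + u * (g + a) + (\<epsilon> * (\<mu> + 1 + s)) * max a b"
        using c(2) by blast
      have "s \<ge> 0" using s u by simp
      have nn: "u * g \<le> s * g" "\<epsilon> * (\<mu> + 1 + s) * g \<ge> 0" "\<epsilon> * (\<mu> + 1 + s) * a \<ge> 0" "b \<le> (\<mu> + 1 + s) * b"
        "s * b \<ge> 0" "s * g \<ge> 0"
        using \<open>s \<ge> 0\<close> u s * \<epsilon> v by (auto intro!: mult_right_mono simp: mult_le_cancel_right1)
      have "(\<mu> + 1) * (g + a) \<le> c + (\<mu> + 1 + s) * (g + b) + \<epsilon> * (\<mu> + 1 + s) * (g + a)"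
      \<comment> \<open>If \<open>a \<le> b\<close>, then \<open>N\<close> is at most
        \<open>d\<close> and the claim follows from \<open>s \<ge> 0\<close>. Otherwise the maximum
        is \<open>a\<close> and the term \<open>u * a\<close> cancels from
        \<open>key\<close>.\<close>
      proof (cases "a \<le> b")
        case True
        have "(\<mu> + 1) * (g + a) \<le> (\<mu> + 1) * (g + b)"
          using True v by (intro mult_left_mono) auto
        also have "\<dots> \<le> (\<mu> + 1 + s) * (g + b)"
          using * \<open>s \<ge> 0\<close> by (intro mult_right_mono) auto
        finally show ?thesis using c(1) nn unfolding distrib_left[of "\<epsilon> * (\<mu> + 1 + s)"] by linarith
      next
        case False
        then have "(\<mu> + 1 + u) * a \<le> c + b + u * (g + a) + (\<epsilon> * (\<mu> + 1 + s)) * a"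
          using *(6) by (simp add: max_def)
        then show ?thesis
          using nn unfolding distrib_left distrib_right by linarith
      qed
      then show "((\<mu> + 1) / (\<mu> + 1 + s) - \<epsilon>) * ln N \<le> c / (\<mu> + 1 + s) + ln d"
        unfolding * by (rule quotient_exponent_bound[OF v(2)])
    qed (auto simp: k_full_ap_def)
  qed
  have 3: "\<exists>C>0. \<forall>N d. k_full_ap k m N d \<longrightarrow> C * real d powr ((\<mu> + u) / (\<mu> + u + s) - \<epsilon>) \<le> real N"
  proof -
    have v: "\<mu> + u + s \<ge> u" "\<mu> + u + s > 0" "\<mu> + u \<ge> 0" using \<mu>s \<mu> s u by auto
    obtain c where c: "c \<ge> 0" "\<And>N d. k_full_ap k m N d \<Longrightarrow>
      \<exists>g a b. g \<ge> 0 \<and> a \<ge> 0 \<and> b \<ge> 0 \<and> ln (gcd d N) = g \<and> ln N = g + a \<and> ln d = g + b \<and>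
      ln (max d N) = g + max a b \<and> (\<mu> + 1 + u) * max a b \<le> c + b + u * (g + a) + (\<epsilon> * (\<mu> + u + s)) * max a b"
      using key[of "\<epsilon> * (\<mu> + u + s)"] \<epsilon> v by auto
    show ?thesis
    proof (intro exI[of _ "exp (- (c / (\<mu> + u + s)))"] conjI allI impI powr_le_of_ln_le)
      fix N d assume Nd: "k_full_ap k m N d"
      then obtain g a b where *: "g \<ge> 0" "a \<ge> 0" "b \<ge> 0" "ln N = g + a" "ln d = g + b"
        "(\<mu> + 1 + u) * max a b \<le> c + b + u * (g + a) + (\<epsilon> * (\<mu> + u + s)) * max a b"
        using c(2) by blast
      have "s \<ge> 0" using s u by simp
      have nn: "u * g \<le> s * g" "\<epsilon> * (\<mu> + u + s) * g \<ge> 0" "\<epsilon> * (\<mu> + u + s) * b \<ge> 0"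
        "u * a \<le> (\<mu> + u + s) * a" "s * a \<ge> 0"
        using \<open>s \<ge> 0\<close> u s * \<epsilon> v by (auto intro!: mult_right_mono)
      have "(\<mu> + u) * (g + b) \<le> c + (\<mu> + u + s) * (g + a) + \<epsilon> * (\<mu> + u + s) * (g + b)"
      \<comment> \<open>Now the case of maximum \<open>b\<close> is the substantial one:
        \<open>b\<close> cancels from \<open>key\<close>, leaving \<open>\<mu> + u\<close> on the
        left, and \<open>u * a\<close> is absorbed because the denominator is at least
        \<open>u\<close>.\<close>
      proof (cases "b \<le> a")
        case True
        have "(\<mu> + u) * (g + b) \<le> (\<mu> + u) * (g + a)"
          using True v by (intro mult_left_mono) auto
        also have "\<dots> \<le> (\<mu> + u + s) * (g + a)"
          using * \<open>s \<ge> 0\<close> by (intro mult_right_mono) auto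
        finally show ?thesis using c(1) nn unfolding distrib_left[of "\<epsilon> * (\<mu> + u + s)"] by linarith
      next
        case False
        then have "(\<mu> + 1 + u) * b \<le> c + b + u * (g + a) + (\<epsilon> * (\<mu> + u + s)) * b"
          using *(6) by (simp add: max_def)
        then show ?thesis
          using nn unfolding distrib_left distrib_right by linarith
      qed
      then show "((\<mu> + u) / (\<mu> + u + s) - \<epsilon>) * ln d \<le> c / (\<mu> + u + s) + ln N"
        unfolding * by (rule quotient_exponent_bound[OF v(2)])
    qed (auto simp: k_full_ap_def)
  qed
  obtain C1 C2 C3 where C: "C1 > 0" "C2 > 0" "C3 > 0"
    "\<And>N d. k_full_ap k m N d \<Longrightarrow> C1 * real (max d N) powr (\<mu> / (\<mu> + s) - \<epsilon>) \<le> real (gcd d N)"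
    "\<And>N d. k_full_ap k m N d \<Longrightarrow> C2 * real N powr ((\<mu> + 1) / (\<mu> + 1 + s) - \<epsilon>) \<le> real d"
    "\<And>N d. k_full_ap k m N d \<Longrightarrow> C3 * real d powr ((\<mu> + u) / (\<mu> + u + s) - \<epsilon>) \<le> real N"
    using 1 2 3 by blast
  show ?thesis unfolding exps
    by (intro exI[of _ "min C1 (min C2 C3)"] conjI allI impI)
       (use C(1-3) in \<open>auto simp: k_full_ap_def intro!: order_trans[OF mult_right_mono C(4)]
          order_trans[OF mult_right_mono C(5)] order_trans[OF mult_right_mono C(6)]\<close>)
qed

theorem theorem1:
  fixes m k :: nat
  assumes abc: abc_conjecture
    and m: "m \<ge> 3"
    and k: "k \<ge> 2"
  shows "(\<forall>\<epsilon>>0::real. \<exists>C>0::real. \<forall>N d::nat. N > 0 \<longrightarrow> d > 0 \<longrightarrow>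
            (\<forall>i<m. k_full k (N + i * d)) \<longrightarrow>
              real (gcd d N) \<ge> C * real (max d N) powr
                ((m * (1 - 1 / k) - 2) / (m * (1 - 1 / k ^ 2) - 2) - \<epsilon>) \<and>
              real d \<ge> C * real N powr
                ((m * (1 - 1 / k) - 1) / (m * (1 - 1 / k ^ 2) - 1) - \<epsilon>) \<and>
              real N \<ge> C * real d powr
                ((m * (1 - 1 / k) + 1 / k - 2) / (m * (1 - 1 / k ^ 2) + 1 / k - 2) - \<epsilon>))
       \<and> (m \<ge> 2 * k - 1 \<longrightarrow>
          (\<forall>\<epsilon>>0::real. \<exists>C>0::real. \<forall>N d::nat. N > 0 \<longrightarrow> d > 0 \<longrightarrow>
            (\<forall>i<m. k_full k (N + i * d)) \<longrightarrow>
              real (gcd d N) \<ge> C * real (max d N) powr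
                ((m * (1 - 1 / k) - 2) / (m * (1 - 1 / (2 * real k - 1)) - 2) - \<epsilon>) \<and>
              real d \<ge> C * real N powr
                ((m * (1 - 1 / k) - 1) / (m * (1 - 1 / (2 * real k - 1)) - 1) - \<epsilon>) \<and>
              real N \<ge> C * real d powr
                ((m * (1 - 1 / k) + 1 / k - 2) / (m * (1 - 1 / (2 * real k - 1)) + 1 / k - 2) - \<epsilon>)))"
proof (intro conjI impI allI)
  \<comment> \<open>From (k - 1)^2 \<ge> 0. Thus \<sigma> = 1/k^2 is admissible in
    \<open>k_full_ap_exponents\<close>; the second half takes the extreme value \<sigma> = 1/(2k -
    1).\<close>
  have "2 * real k - 1 \<le> real k ^ 2"
    using zero_le_power2[of "real k - 1"] by (simp add: power2_eq_square algebra_simps)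
  then have "1 / real k ^ 2 \<le> 1 / (2 * real k - 1)"
    using k by (intro divide_left_mono mult_pos_pos) auto
  then show "\<exists>C>0::real. \<forall>N d::nat. N > 0 \<longrightarrow> d > 0 \<longrightarrow>
            (\<forall>i<m. k_full k (N + i * d)) \<longrightarrow>
              real (gcd d N) \<ge> C * real (max d N) powr
                ((m * (1 - 1 / k) - 2) / (m * (1 - 1 / k ^ 2) - 2) - \<epsilon>) \<and>
              real d \<ge> C * real N powr
                ((m * (1 - 1 / k) - 1) / (m * (1 - 1 / k ^ 2) - 1) - \<epsilon>) \<and>
              real N \<ge> C * real d powr
                ((m * (1 - 1 / k) + 1 / k - 2) / (m * (1 - 1 / k ^ 2) + 1 / k - 2) - \<epsilon>)"
    if "\<epsilon> > 0" for \<epsilon> :: real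
    using k_full_ap_exponents[OF abc m k that, of "1 / real k ^ 2"] by simp
qed (use k_full_ap_exponents[OF abc m k _ order_refl] in blast)

end
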